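(* Let $(X,T)$ be a rank-one subshift and let $(Y,S)$ be a subshift. Suppose that $(Y,S)$ is a topological factor of $(X,T)$. Then either $Y$ is finite or $(X,T)$ is (topologically) isomorphic to $(Y,S)$.
   Context: A subshift is a topological dynamical system $(X,T)$ where, for some integer $b>1$, $X$ is a closed shift-invariant subset of $b^{\mathbb{Z}}=\{0,\dots,b-1\}^{\mathbb{Z}}$ (product topology) and $T$ is the shift map $(Tx)(k)=x(k+1)$. The alphabet sizes of $X$ and $Y$ may differ; $S$ denotes the shift map on $Y$. Rank-one subshift: Let $(q_n)_{n\ge 0}$ be a sequence of integers $>1$ (the cutting parameter) and $(a_{n,i})_{n\ge 0,\,1\le i<q_n}$ a doubly-indexed sequence of non-negative integers (the spacer parameter). Define binary words by $v_0=0$ and $$v_{n+1}=v_n1^{a_{n,1}}v_n1^{a_{n,2}}v_n\cdots v_n1^{a_{n,q_n-1}}v_n .$$ Each $v_n$ is an initial segment of $v_{n+1}$; let $V=\lim_{n\to\infty}v_n$ be the resulting (one-sided) infinite word. The rank-one subshift determined by these parameters is $(X_V,T)$ with $$X_V=\{x\in 2^{\mathbb{Z}} : \text{every finite subword of } x \text{ is a subword of } V\}$$ and $T$ the shift map. A rank-one subshift is any subshift of the form $(X_V,T)$ for such parameters. $(Y,S)$ is a topological factor of $(X,T)$ if there is a continuous surjection $\varphi:X\to Y$ with $\varphi(Tx)=S\varphi(x)$ for all $x\in X$. The systems are isomorphic if there is such a $\varphi$ that is a homeomorphism. *)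

theory Defs
  imports "HOL-Analysis.Analysis" "HOL-Library.Sublist"
begin

text \<open>
  Bi-infinite sequences are functions of type \<open>int \<Rightarrow> nat\<close>. Their type-class topology is the product
  of the discrete topologies on \<open>nat\<close>, so it induces the usual product topology on
  each \<open>full_shift b\<close>, and \<open>full_shift b\<close> is closed in it.
\<close>

definition full_shift :: "nat \<Rightarrow> (int \<Rightarrow> nat) set" where
  "full_shift b = {x. \<forall>k. x k \<in> {0..<b}}"

definition shift :: "(int \<Rightarrow> nat) \<Rightarrow> (int \<Rightarrow> nat)" where
  "shift x = (\<lambda>k. x (k + 1))"

definition subshift :: "(int \<Rightarrow> nat) set \<Rightarrow> bool" where
  "subshift X \<longleftrightarrow> (\<exists>b>1. X \<subseteq> full_shift b \<and> closed X \<and> shift ` X = X)"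

definition is_factor_map :: "(int \<Rightarrow> nat) set \<Rightarrow> (int \<Rightarrow> nat) set \<Rightarrow> ((int \<Rightarrow> nat) \<Rightarrow> (int \<Rightarrow> nat)) \<Rightarrow> bool" where
  "is_factor_map X Y \<phi> \<longleftrightarrow>
     continuous_on X \<phi> \<and> \<phi> ` X = Y \<and> (\<forall>x\<in>X. \<phi> (shift x) = shift (\<phi> x))"

definition topological_factor :: "(int \<Rightarrow> nat) set \<Rightarrow> (int \<Rightarrow> nat) set \<Rightarrow> bool" where
  "topological_factor Y X \<longleftrightarrow> (\<exists>\<phi>. is_factor_map X Y \<phi>)"

definition topologically_isomorphic :: "(int \<Rightarrow> nat) set \<Rightarrow> (int \<Rightarrow> nat) set \<Rightarrow> bool" where
  "topologically_isomorphic X Y \<longleftrightarrow>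
     (\<exists>\<phi>. is_factor_map X Y \<phi> \<and> (\<exists>\<psi>. homeomorphism X Y \<phi> \<psi>))"

text \<open>Only the values \<open>a n i\<close> with \<open>1 \<le> i < q n\<close> of the spacer parameter are used.\<close>

primrec rank_one_word :: "(nat \<Rightarrow> nat) \<Rightarrow> (nat \<Rightarrow> nat \<Rightarrow> nat) \<Rightarrow> nat \<Rightarrow> nat list" where
  "rank_one_word q a 0 = [0]"
| "rank_one_word q a (Suc n) =
     concat (map (\<lambda>i. rank_one_word q a n @ replicate (a n i) 1) [1..<q n]) @ rank_one_word q a n"

text \<open>
  The words \<open>rank_one_word q a n\<close> are nested prefixes of unbounded length if all \<open>q n > 1\<close>, so any
  sufficiently long one determines the \<open>k\<close>-th letter of the limit; see
  \<open>prefix_rank_one_limit\<close> below.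
\<close>

definition rank_one_limit :: "(nat \<Rightarrow> nat) \<Rightarrow> (nat \<Rightarrow> nat \<Rightarrow> nat) \<Rightarrow> nat \<Rightarrow> nat" where
  "rank_one_limit q a k =
     rank_one_word q a (LEAST n. k < length (rank_one_word q a n)) ! k"

definition finite_subwords :: "(int \<Rightarrow> nat) \<Rightarrow> nat list set" where
  "finite_subwords x = {map (\<lambda>j. x (i + int j)) [0..<m] | i m. True}"

definition finite_subwords_one_sided :: "(nat \<Rightarrow> nat) \<Rightarrow> nat list set" where
  "finite_subwords_one_sided V = {map (\<lambda>j. V (i + j)) [0..<m] | i m. True}"

definition shift_space_of_word :: "(nat \<Rightarrow> nat) \<Rightarrow> (int \<Rightarrow> nat) set" where
  "shift_space_of_word V = {x \<in> full_shift 2. finite_subwords x \<subseteq> finite_subwords_one_sided V}"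

definition rank_one_subshift :: "(int \<Rightarrow> nat) set \<Rightarrow> bool" where
  "rank_one_subshift X \<longleftrightarrow>
     (\<exists>q a. (\<forall>n. q n > 1) \<and> X = shift_space_of_word (rank_one_limit q a))"

lemma prefix_rank_one_word_Suc:
  assumes "q n > 1"
  shows "prefix (rank_one_word q a n) (rank_one_word q a (Suc n))"
  using assms by (simp add: upt_conv_Cons)

lemma prefix_rank_one_word:
  assumes "\<And>n. q n > 1" and "m \<le> n"
  shows "prefix (rank_one_word q a m) (rank_one_word q a n)"
  using assms(2)
proof (induction n rule: dec_induct)
  case (step n)
  then show ?case
    using prefix_rank_one_word_Suc[of q n a] assms(1) prefix_order.trans by blast
qed simp

lemma length_rank_one_word:
  assumes "\<And>n. q n > 1"
  shows "n < length (rank_one_word q a n)"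
proof (induction n)
  case (Suc n)
  have "length (rank_one_word q a (Suc n)) \<ge> 2 * length (rank_one_word q a n)"
    using assms[of n] by (simp add: upt_conv_Cons)
  with Suc show ?case by linarith
qed simp

lemma prefix_rank_one_limit:
  assumes "\<And>n. q n > 1"
  shows "map (rank_one_limit q a) [0..<length (rank_one_word q a n)] = rank_one_word q a n"
proof (rule nth_equalityI)
  fix k
  assume "k < length (map (rank_one_limit q a) [0..<length (rank_one_word q a n)])"
  then have k: "k < length (rank_one_word q a n)" by simp
  define m where "m = (LEAST n. k < length (rank_one_word q a n))"
  have m: "k < length (rank_one_word q a m)" "m \<le> n"
    unfolding m_def using k by (rule LeastI, rule Least_le)
  have "prefix (rank_one_word q a m) (rank_one_word q a n)"
    using assms m(2) by (rule prefix_rank_one_word)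
  then have "rank_one_word q a n ! k = rank_one_word q a m ! k"
    using m(1) by (auto simp: prefix_def nth_append)
  then show "map (rank_one_limit q a) [0..<length (rank_one_word q a n)] ! k = rank_one_word q a n ! k"
    using k by (simp add: rank_one_limit_def m_def)
qed simp

end

theory Submission
  imports Defs
begin

text \<open>
  A factor map is a sliding block code \<open>f\<close>. If the image of \<open>V\<close> under \<open>f\<close> is periodic, then \<open>Y\<close> is
  finite. Otherwise the map is injective: let \<open>x\<close> and \<open>x'\<close> have the same image, and
  cut both into copies of a long \<open>v\<^sub>n\<close> separated by spacers. Two distinct starting positions, one of
  \<open>x\<close> and one of \<open>x'\<close>, cannot be close, as their distance would be a period of the image of
  \<open>v\<^sub>n\<close>. If some copy in \<open>x\<close> is aligned with a copy in \<open>x'\<close>, this forces all copies to be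
  aligned, and \<open>x = x'\<close>. If no copies are aligned, then the copies in \<open>x\<close> and \<open>x'\<close> interleave.
  Applied at one fixed level this bounds the spacers of \<open>x\<close> and \<open>x'\<close>. At a much higher level,
  consecutive offsets between the two interleaved tilings are then periods of the image of \<open>v\<^sub>n\<close>
  that differ by a bounded amount, and by aperiodicity they are equal. So \<open>x'\<close> is a shift of \<open>x\<close>, and
  the common image, hence the image of \<open>V\<close>, is periodic after all.
\<close>

section \<open>Collisions of tilings under block codes\<close>

text \<open>The index type is generic so that one code acts both on the one-sided word
  \<open>V\<close> and on two-sided points. For the same reason the window only reaches to the
  right.\<close>

definition block_code :: "(nat list \<Rightarrow> nat) \<Rightarrow> nat \<Rightarrow> ('i::semiring_1 \<Rightarrow> nat) \<Rightarrow> 'i \<Rightarrow> nat" where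
  "block_code f m x k = f (map (\<lambda>j. x (k + of_nat j)) [0..<m])"

text \<open>\<open>P\<close> holds the starts of the copies; every letter outside them is a spacer
  1, so \<open>P\<close> determines \<open>x\<close>. \<open>P\<close> may be empty or bounded on a
  side, as a point of a rank-one subshift may end in an infinite run of spacers.\<close>

definition tiles :: "(nat \<Rightarrow> nat) \<Rightarrow> nat \<Rightarrow> int set \<Rightarrow> (int \<Rightarrow> nat) \<Rightarrow> bool" where
  "tiles V L P x \<longleftrightarrow>
     (\<forall>p\<in>P. \<forall>i<L. x (p + int i) = V i) \<and>
     (\<forall>k. x k \<noteq> 1 \<longrightarrow> (\<exists>p\<in>P. p \<le> k \<and> k < p + int L)) \<and>
     (\<forall>p\<in>P. \<forall>p'\<in>P. p < p' \<longrightarrow> p + int L \<le> p')"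

lemma block_code_cong:
  fixes x :: "'i::semiring_1 \<Rightarrow> nat" and y :: "'j::semiring_1 \<Rightarrow> nat"
  assumes "\<And>j. j < m \<Longrightarrow> x (k + of_nat j) = y (l + of_nat j)"
  shows "block_code f m x k = block_code f m y l"
  unfolding block_code_def using assms by (intro arg_cong[where f = f]) auto

lemma tilesD:
  assumes "tiles V L P x"
  shows "p \<in> P \<Longrightarrow> i < L \<Longrightarrow> x (p + int i) = V i"
    and "x k \<noteq> 1 \<Longrightarrow> \<exists>p\<in>P. p \<le> k \<and> k < p + int L"
    and "p \<in> P \<Longrightarrow> p' \<in> P \<Longrightarrow> p < p' \<Longrightarrow> p + int L \<le> p'"
  using assms unfolding tiles_def by blast+

lemma tiles_unique:
  assumes "tiles V L P x" and "tiles V L P x'"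
  shows "x = x'"
proof
  fix k
  show "x k = x' k"
  proof (cases "\<exists>p\<in>P. p \<le> k \<and> k < p + int L")
    case True
    then obtain p where p: "p \<in> P" "p \<le> k" "k < p + int L" by blast
    define i where "i = nat (k - p)"
    have "k = p + int i" "i < L" using p by (auto simp: i_def)
    then show ?thesis using tilesD(1)[OF assms(1) p(1)] tilesD(1)[OF assms(2) p(1)] by simp
  next
    case False
    then have "x k = 1" "x' k = 1" using tilesD(2)[OF assms(1)] tilesD(2)[OF assms(2)] by blast+
    then show ?thesis by simp
  qed
qed

lemma tiles_shift:
  assumes "tiles V L P x"
  shows "tiles V L ((\<lambda>p. p - r) ` P) (\<lambda>k. x (k + r))"
proof -
  have "\<exists>p\<in>P. p - r \<le> k \<and> k < p - r + int L" if "x (k + r) \<noteq> 1" for k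
    using tilesD(2)[OF assms that] by force
  then show ?thesis
    using tilesD(1,3)[OF assms] unfolding tiles_def by (force simp: algebra_simps)
qed

lemma block_code_tile:
  assumes "tiles V L P x" and "p \<in> P" and "i + m \<le> L"
  shows "block_code f m x (p + int i) = block_code f m V i"
proof (rule block_code_cong)
  fix j assume "j < m"
  then show "x (p + int i + of_nat j) = V (i + of_nat j)"
    using tilesD(1)[OF assms(1,2), of "i + j"] assms(3) by (simp add: add.assoc)
qed

text \<open>Two sequences, tiled by the same word (the first \<open>L\<close> letters of \<open>V\<close>), with the same image under a
  block code. The length \<open>l\<close> is that of a fixed shorter \<open>v\<^sub>n\<close>, which begins and ends the tile and
  whose image is not constant; \<open>D\<close> bounds the periods that the image of the tile lacks.\<close>

locale tiled_collision =
  fixes V :: "nat \<Rightarrow> nat" and f :: "nat list \<Rightarrow> nat" and m l L D :: nat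
    and x x' :: "int \<Rightarrow> nat" and P P' :: "int set"
  assumes V0: "V 0 = 0"
    and l_le: "l \<le> L" "l \<le> D"
    and suffix: "\<And>i. i < l \<Longrightarrow> V (L - l + i) = V i"
    and nonconst: "\<exists>i. Suc i + m \<le> l \<and> block_code f m V i \<noteq> block_code f m V (Suc i)"
    and nonper: "\<And>d. 1 \<le> d \<Longrightarrow> d \<le> D \<Longrightarrow>
                   \<exists>i. i + d + m \<le> L \<and> block_code f m V i \<noteq> block_code f m V (i + d)"
    and tiles: "tiles V L P x"
    and tiles': "tiles V L P' x'"
    and same: "block_code f m x = block_code f m x'"
begin

lemma swap: "tiled_collision V f m l L D x' x P' P"
  using V0 l_le suffix nonconst nonper tiles tiles' same
  unfolding tiled_collision_def by auto

lemma L_pos: "0 < L"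
  using l_le nonconst by auto

lemma x_start: "p \<in> P \<Longrightarrow> x p \<noteq> 1"
  using tilesD(1)[OF tiles, of p 0] L_pos V0 by simp

text \<open>On a run of 1s the block code has constant image, while the image of the short word is
  not constant.\<close>

lemma not_ones:
  assumes "\<And>i. i < l \<Longrightarrow> x (k + int i) = V i"
  shows "\<exists>i<l. x' (k + int i) \<noteq> 1"
proof (rule ccontr)
  assume "\<not> ?thesis"
  then have ones: "x' (k + int i) = 1" if "i < l" for i using that by blast
  obtain i where i: "Suc i + m \<le> l" "block_code f m V i \<noteq> block_code f m V (Suc i)"
    using nonconst by blast
  have eq: "block_code f m V j = block_code f m x (k + int j)" if "j + m \<le> l" for j
    using that assms[of "j + _"] by (intro block_code_cong) (simp add: add.assoc)
  have "block_code f m x' (k + int i) = block_code f m x' (k + int (Suc i))"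
  proof (rule block_code_cong)
    fix j assume "j < m"
    then show "x' (k + int i + of_nat j) = x' (k + int (Suc i) + of_nat j)"
      using ones[of "i + j"] ones[of "Suc i + j"] i(1) by (simp add: algebra_simps)
  qed
  then show False using i eq[of i] eq[of "Suc i"] same by simp
qed

lemma not_ones_start:
  assumes "p \<in> P"
  shows "\<exists>k. p \<le> k \<and> k < p + int l \<and> x' k \<noteq> 1"
proof -
  have "x (p + int i) = V i" if "i < l" for i
    using tilesD(1)[OF tiles assms] that l_le by simp
  from not_ones[OF this] obtain i where "i < l" "x' (p + int i) \<noteq> 1" by blast
  then show ?thesis by (intro exI[of _ "p + int i"]) auto
qed

lemma not_ones_end:
  assumes "p \<in> P"
  shows "\<exists>k. p + int L - int l \<le> k \<and> k < p + int L \<and> x' k \<noteq> 1"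
proof -
  \<comment> \<open>The tile also ends with the short word, so \<open>not_ones\<close> applies at
    its right end.\<close>
  have "x (p + int L - int l + int i) = V i" if "i < l" for i
    using tilesD(1)[OF tiles assms, of "L - l + i"] suffix[OF that] that l_le
    by (simp add: of_nat_diff algebra_simps)
  from not_ones[OF this] obtain i where "i < l" "x' (p + int L - int l + int i) \<noteq> 1" by blast
  then show ?thesis by (intro exI[of _ "p + int L - int l + int i"]) auto
qed

text \<open>Where a copy in \<open>x\<close> and a copy in \<open>x'\<close> overlap, the common
  image reads the coded tile at two positions that differ by \<open>p - p'\<close>.\<close>

lemma code_period:
  assumes "p \<in> P" and "p' \<in> P'" and "p' \<le> p" and "i + nat (p - p') + m \<le> L"
  shows "block_code f m V i = block_code f m V (i + nat (p - p'))"
proof -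
  have "block_code f m V i = block_code f m x (p + int i)"
    using block_code_tile[OF tiles assms(1)] assms(4) by simp
  also have "p + int i = p' + int (i + nat (p - p'))"
    using assms(3) by simp
  also have "block_code f m x \<dots> = block_code f m x' \<dots>"
    by (simp add: same)
  also have "\<dots> = block_code f m V (i + nat (p - p'))"
    by (rule block_code_tile[OF tiles' assms(2,4)])
  finally show ?thesis .
qed

lemma far_aux:
  assumes "p \<in> P" and "p' \<in> P'" and "p' < p"
  shows "int D < p - p'"
proof (rule ccontr)
  assume "\<not> ?thesis"
  then have "1 \<le> nat (p - p')" "nat (p - p') \<le> D" using assms by auto
  then obtain i where i: "i + nat (p - p') + m \<le> L"
    "block_code f m V i \<noteq> block_code f m V (i + nat (p - p'))"
    using nonper by blast
  then show False using code_period[OF assms(1,2) _ i(1)] assms(3) by simp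
qed

lemma far:
  assumes "p \<in> P" and "p' \<in> P'" and "p \<noteq> p'"
  shows "int D < \<bar>p - p'\<bar>"
proof -
  interpret swap: tiled_collision V f m l L D x' x P' P by (rule swap)
  show ?thesis using far_aux[of p p'] swap.far_aux[of p' p] assms by (cases "p' < p") auto
qed

text \<open>At the end of the tile \<open>t\<close> that faces \<open>p\<close>, \<open>x'\<close>
  has a letter other than 1, covered by some tile \<open>p'\<close>. If \<open>p'\<close> starts on
  the side of \<open>t\<close> towards \<open>p\<close>, the induction hypothesis puts it into
  \<open>P\<close>, where it would overlap \<open>t\<close>. If it starts on the other side, it is
  less than \<open>l\<close> away from \<open>t\<close>, against \<open>far\<close>.\<close>

lemma aligned_step:
  assumes "p \<in> P" and "p \<in> P'" and t: "t \<in> P"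
    and IH: "\<And>s. \<bar>s - p\<bar> < \<bar>t - p\<bar> \<Longrightarrow> s \<in> P \<longleftrightarrow> s \<in> P'"
  shows "t \<in> P'"
proof (rule ccontr)
  assume nt: "t \<notin> P'"
  consider "p < t" | "t < p" using nt assms by fastforce
  then show False
  proof cases
    case 1
    obtain k where k: "t \<le> k" "k < t + int l" "x' k \<noteq> 1" using not_ones_start[OF t] by blast
    obtain p' where p': "p' \<in> P'" "p' \<le> k" "k < p' + int L" using tilesD(2)[OF tiles' k(3)] by blast
    have "p + int L \<le> t" using tilesD(3)[OF tiles] assms 1 by blast
    then have "p \<le> p'" using tilesD(3)[OF tiles' p'(1) assms(2)] p' k by linarith
    have "\<not> p' < t"
    proof
      assume "p' < t"
      then have "p' \<in> P" using IH[of p'] p' \<open>p \<le> p'\<close> by simp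
      then show False using tilesD(3)[OF tiles _ t] \<open>p' < t\<close> p' k by force
    qed
    then have "t < p'" using p' nt by (cases "p' = t") auto
    then show False using far[OF t p'(1)] p' k l_le by simp
  next
    case 2
    obtain k where k: "t + int L - int l \<le> k" "k < t + int L" "x' k \<noteq> 1"
      using not_ones_end[OF t] by blast
    obtain p' where p': "p' \<in> P'" "p' \<le> k" "k < p' + int L" using tilesD(2)[OF tiles' k(3)] by blast
    have "t + int L \<le> p" using tilesD(3)[OF tiles] assms 2 by blast
    then have "p' < p" using p' k by linarith
    have "\<not> t < p'"
    proof
      assume "t < p'"
      then have "p' \<in> P" using IH[of p'] p' \<open>p' < p\<close> by simp
      then show False using tilesD(3)[OF tiles t] \<open>t < p'\<close> p' k by force
    qed
    then have "p' < t" using p' nt by (cases "p' = t") auto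
    then show False using far[OF t p'(1)] p' k l_le by simp
  qed
qed

lemma aligned_imp_eq:
  assumes "P \<inter> P' \<noteq> {}"
  shows "x = x'"
proof -
  interpret swap: tiled_collision V f m l L D x' x P' P by (rule swap)
  obtain p where p: "p \<in> P" "p \<in> P'" using assms by blast
  have "t \<in> P \<longleftrightarrow> t \<in> P'" for t
  \<comment> \<open>Alignment spreads outwards from the common start \<open>p\<close>, in both
    tilings at once.\<close>
  proof (induction "nat \<bar>t - p\<bar>" arbitrary: t rule: less_induct)
    case less
    then have IH: "s \<in> P \<longleftrightarrow> s \<in> P'" if "\<bar>s - p\<bar> < \<bar>t - p\<bar>" for s
      using that by simp
    show ?case using aligned_step[OF p _ IH] swap.aligned_step[OF p(2,1)] IH by blast
  qed
  then have "P = P'" by blast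
  then show ?thesis using tiles_unique tiles tiles' by blast
qed

end

section \<open>Interleaved tilings\<close>

locale interleaved_collision = tiled_collision +
  assumes disjoint: "P \<inter> P' = {}"
begin

lemma swap': "interleaved_collision V f m l L D x' x P' P"
  using swap disjoint by (simp add: interleaved_collision_def interleaved_collision_axioms_def Int_commute)

lemma far': "p \<in> P \<Longrightarrow> p' \<in> P' \<Longrightarrow> int D < \<bar>p - p'\<bar>"
  using far disjoint by blast

text \<open>Near \<open>p\<close> the sequence \<open>x'\<close> has a letter other than 1. The tile
  covering it cannot start after \<open>p\<close>, since it would be closer than \<open>l\<close>,
  hence than \<open>D\<close> allows; so it starts before \<open>p\<close> and reaches past
  it.\<close>

lemma previous:
  assumes "p \<in> P"
  shows "\<exists>p'\<in>P'. p' < p \<and> p < p' + int L"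
proof -
  obtain k where k: "p \<le> k" "k < p + int l" "x' k \<noteq> 1" using not_ones_start[OF assms] by blast
  obtain p' where p': "p' \<in> P'" "p' \<le> k" "k < p' + int L" using tilesD(2)[OF tiles' k(3)] by blast
  have "p' < p" using far'[OF assms p'(1)] k p' l_le by linarith
  then show ?thesis using p' k by force
qed

lemma following:
  assumes "p \<in> P"
  shows "\<exists>p'\<in>P'. p < p' \<and> p' < p + int L"
proof -
  obtain k where k: "p + int L - int l \<le> k" "k < p + int L" "x' k \<noteq> 1"
    using not_ones_end[OF assms] by blast
  obtain p' where p': "p' \<in> P'" "p' \<le> k" "k < p' + int L" using tilesD(2)[OF tiles' k(3)] by blast
  have "p < p'" using far'[OF assms p'(1)] k p' l_le by linarith
  then show ?thesis using p' k by force
qed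

text \<open>Following tiles alternately in \<open>x'\<close> and in \<open>x\<close> leads
  arbitrarily far to the right, so there is a first start at or after \<open>k\<close>. Two steps
  back from it, each shorter than \<open>L\<close>, lead to an earlier start, which by minimality
  lies before \<open>k\<close>.\<close>

lemma syndetic:
  assumes "P \<noteq> {}"
  shows "\<exists>p\<in>P. k \<le> p \<and> p < k + 2 * int L"
proof -
  interpret swap: interleaved_collision V f m l L D x' x P' P by (rule swap')
  obtain p0 where p0: "p0 \<in> P" using assms by blast
  have up: "\<exists>p\<in>P. p0 + int j \<le> p" for j
  proof (induction j)
    case 0
    then show ?case using p0 by auto
  next
    case (Suc j)
    then obtain p where p: "p \<in> P" "p0 + int j \<le> p" by blast
    obtain p' where "p' \<in> P'" "p < p'" using following[OF p(1)] by blast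
    moreover from this obtain q where "q \<in> P" "p' < q" using swap.following by blast
    ultimately show ?case using p by (intro bexI[of _ q]) auto
  qed
  define Q where "Q = (\<lambda>j. k + int j \<in> P)"
  obtain p where p: "p \<in> P" "p0 + int (nat (k - p0)) \<le> p" using up by blast
  then have "k \<le> p" by linarith
  with p have ex: "Q (nat (p - k))" by (simp add: Q_def)
  define j where "j = (LEAST j. Q j)"
  have j: "Q j" "\<And>i. i < j \<Longrightarrow> \<not> Q i"
    unfolding j_def using ex by (auto intro: LeastI dest: not_less_Least)
  have q: "k + int j \<in> P" using j(1) by (simp add: Q_def)
  obtain p' where p': "p' \<in> P'" "p' < k + int j" "k + int j < p' + int L" using previous[OF q] by blast
  obtain p1 where p1: "p1 \<in> P" "p1 < p'" "p' < p1 + int L" using swap.previous[OF p'(1)] by blast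
  have "p1 < k"
  proof (rule ccontr)
    assume "\<not> p1 < k"
    then have "Q (nat (p1 - k))" using p1 by (simp add: Q_def)
    moreover have "nat (p1 - k) < j" using p1 p' \<open>\<not> p1 < k\<close> by linarith
    ultimately show False using j(2) by blast
  qed
  then show ?thesis using q p1 p' by (intro bexI[of _ "k + int j"]) auto
qed

lemma syndetic_non_one:
  assumes "P \<noteq> {}"
  shows "\<exists>j. k \<le> j \<and> j < k + 2 * int L \<and> x j \<noteq> 1"
  using syndetic[OF assms, of k] x_start by blast

end

text \<open>\<open>S\<close> bounds the runs of 1s and will come from a fixed lower level,
  independently of \<open>L\<close>. \<open>K\<close> is a prefix length on which every positive
  period up to \<open>S\<close> fails. Through \<open>D_large\<close>, distances between starts of
  the two tilings exceed \<open>S + K\<close>.\<close>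

locale rigid_collision = interleaved_collision +
  fixes S K :: nat
  assumes non_one: "\<And>k. \<exists>j. k \<le> j \<and> j < k + int S \<and> x j \<noteq> 1"
    and non_one': "\<And>k. \<exists>j. k \<le> j \<and> j < k + int S \<and> x' j \<noteq> 1"
    and nonper_short: "\<And>d. 1 \<le> d \<Longrightarrow> d \<le> S \<Longrightarrow>
                   \<exists>i. i + d + m \<le> K \<and> block_code f m V i \<noteq> block_code f m V (i + d)"
    and D_large: "S + K \<le> D"
    and nonempty: "P \<noteq> {}"
begin

lemma swap'': "rigid_collision V f m l L D x' x P' P S K"
proof -
  have "P' \<noteq> {}" using nonempty previous by blast
  then show ?thesis
    using swap' non_one non_one' nonper_short D_large
    by (simp add: rigid_collision_def rigid_collision_axioms_def)
qed

text \<open>No whole tile fits between the copies at \<open>p\<close> and \<open>q\<close>, so only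
  1s separate them, and a run of 1s is shorter than \<open>S\<close>.\<close>

lemma short_gap:
  assumes "p \<in> P" "q \<in> P" "p < q" "q < p + 2 * int L"
  shows "q < p + int L + int S"
proof -
  obtain k where k: "p + int L \<le> k" "k < p + int L + int S" "x k \<noteq> 1" using non_one by blast
  obtain p1 where p1: "p1 \<in> P" "p1 \<le> k" "k < p1 + int L" using tilesD(2)[OF tiles k(3)] by blast
  have "p < p1" using k p1 by linarith
  then have "p + int L \<le> p1" using tilesD(3)[OF tiles assms(1) p1(1)] by blast
  then have "\<not> p1 < q" using tilesD(3)[OF tiles p1(1) assms(2)] assms(4) by linarith
  then show ?thesis using p1 k by linarith
qed

text \<open>The offsets \<open>p - p'\<close> and \<open>q - q'\<close> are periods of the coded tile, so their difference is a period
  of a long prefix.\<close>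

lemma period_bound:
  assumes "p \<in> P" "p' \<in> P'" "q \<in> P" "q' \<in> P'" "p' < p" "q' < q"
    and "p - p' + int K \<le> int L" "q - q' + int K \<le> int L"
    and "p - p' \<le> q - q'" and "(q - q') - (p - p') \<le> int S"
  shows "p - p' = q - q'"
proof (rule ccontr)
  assume neq: "\<not> ?thesis"
  define d where "d = nat ((q - q') - (p - p'))"
  have "1 \<le> d" "d \<le> S" using neq assms by (auto simp: d_def)
  then obtain i where i: "i + d + m \<le> K" "block_code f m V i \<noteq> block_code f m V (i + d)"
    using nonper_short by blast
  have e: "nat (q - q') = d + nat (p - p')" using assms by (simp add: d_def)
  have "block_code f m V i = block_code f m V (i + nat (q - q'))"
    using assms i by (intro code_period) auto
  also have "\<dots> = block_code f m V (i + d + nat (p - p'))" by (simp add: e add.assoc)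
  also have "\<dots> = block_code f m V (i + d)"
  proof -
    have "i + d + nat (p - p') + m \<le> L" using assms(5,7) i(1) by linarith
    then show ?thesis using code_period[OF assms(1,2)] assms by simp
  qed
  finally show False using i by simp
qed

text \<open>The two offsets differ by \<open>(q - p) - (d - c)\<close>. Both gaps lie between
  \<open>L\<close> and \<open>L + S\<close>, so this is less than \<open>S\<close> in absolute
  value, and \<open>period_bound\<close> applies with the smaller offset first.\<close>

lemma offset_step:
  assumes P: "c \<in> P'" "p \<in> P" "d \<in> P'" "q \<in> P"
    and ord: "c < p" "p < c + int L" "p < d" "d < p + int L" "d < q" "q < d + int L"
  shows "p - c = q - d"
proof -
  interpret swap: rigid_collision V f m l L D x' x P' P S K by (rule swap'')
  have 1: "p + int L \<le> q" "c + int L \<le> d"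
    using tilesD(3)[OF tiles P(2,4)] tilesD(3)[OF tiles' P(1,3)] ord by linarith+
  have 2: "q < p + int L + int S" "d < c + int L + int S"
    using short_gap[OF P(2,4)] swap.short_gap[OF P(1,3)] ord by linarith+
  have 3: "int D < d - p" using far'[OF P(2,3)] ord by linarith
  \<comment> \<open>Each offset is a gap below \<open>L + S\<close> minus \<open>d - p\<close>,
    which exceeds \<open>S + K\<close>; this leaves an overlap of \<open>K\<close> letters.\<close>
  have 4: "p - c + int K \<le> int L" "q - d + int K \<le> int L" using 2 3 D_large by linarith+
  show ?thesis
  proof (cases "p - c \<le> q - d")
    case True
    then show ?thesis using period_bound[OF P(2,1,4,3)] ord 1 2 4 by linarith
  next
    case False
    then show ?thesis using period_bound[OF P(4,3,2,1)] ord 1 2 4 by linarith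
  qed
qed

text \<open>The offset \<open>r\<close> of one pair of starts is carried outwards from
  \<open>p0\<close> by \<open>offset_step\<close>, by induction on the distance to
  \<open>p0\<close>.\<close>

lemma constant_offset:
  "\<exists>r>0. P' = (\<lambda>p. p - r) ` P"
proof -
  interpret swap: rigid_collision V f m l L D x' x P' P S K by (rule swap'')
  obtain p0 where p0: "p0 \<in> P" using nonempty by blast
  obtain c0 where c0: "c0 \<in> P'" "c0 < p0" "p0 < c0 + int L" using previous[OF p0] by blast
  define r where "r = p0 - c0"
  have r: "0 < r" "r < int L" using c0 by (auto simp: r_def)
  have mem: "q - r \<in> P'" if "q \<in> P" for q
    using that
  proof (induction "nat \<bar>q - p0\<bar>" arbitrary: q rule: less_induct)
    case less
    consider "q = p0" | "p0 < q" | "q < p0" by linarith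
    then show ?case
    proof cases
      case 1
      then show ?thesis using c0 by (simp add: r_def)
    next
      case 2
      obtain d where d: "d \<in> P'" "d < q" "q < d + int L" using previous[OF less.prems] by blast
      obtain p where p: "p \<in> P" "p < d" "d < p + int L" using swap.previous[OF d(1)] by blast
      \<comment> \<open>As \<open>q < p + 2 * L\<close>, no start in \<open>P\<close> fits strictly
        between \<open>p\<close> and \<open>q\<close>; so \<open>p\<close> is not beyond
        \<open>p0\<close>, and it is closer to \<open>p0\<close> than \<open>q\<close> is.\<close>
      have "p0 \<le> p"
        using tilesD(3)[OF tiles p(1) p0] tilesD(3)[OF tiles p0 less.prems] 2 d p by linarith
      then have "p - r \<in> P'" using less.hyps[of p] p d by simp
      then have "p - (p - r) = q - d"
        by (rule offset_step[OF _ p(1) d(1) less.prems]) (use r p d in auto)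
      then have "q - r = d" by linarith
      then show ?thesis using d by simp
    next
      case 3
      obtain d where d: "d \<in> P'" "q < d" "d < q + int L" using following[OF less.prems] by blast
      obtain p where p: "p \<in> P" "d < p" "p < d + int L" using swap.following[OF d(1)] by blast
      obtain c where c: "c \<in> P'" "c < q" "q < c + int L" using previous[OF less.prems] by blast
      have "p \<le> p0"
        using tilesD(3)[OF tiles p0 p(1)] tilesD(3)[OF tiles less.prems p0] 3 d p by linarith
      then have pr: "p - r \<in> P'" using less.hyps[of p] p d by simp
      \<comment> \<open>Both are starts in \<open>P'\<close> less than \<open>L\<close> below
        \<open>p\<close>, and distinct starts are at least \<open>L\<close> apart.\<close>
      have "p - r = d"
        using tilesD(3)[OF tiles' pr d(1)] tilesD(3)[OF tiles' d(1) pr] p r by linarith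
      moreover have "q - c = p - d"
        by (rule offset_step[OF c(1) less.prems d(1) p(1)]) (use c d p in auto)
      ultimately have "q - r = c" by linarith
      then show ?thesis using c by simp
    qed
  qed
  have "p' \<in> (\<lambda>p. p - r) ` P" if p': "p' \<in> P'" for p'
  proof -
    obtain p where p: "p \<in> P" "p' < p" "p < p' + int L" using swap.following[OF p'] by blast
    have "p - r = p'"
      using tilesD(3)[OF tiles' mem[OF p(1)] p'] tilesD(3)[OF tiles' p' mem[OF p(1)]] p r
      by linarith
    then show ?thesis using p by blast
  qed
  then show ?thesis using mem r by (intro exI[of _ r]) auto
qed

lemma code_periodic:
  "\<exists>r>0. \<forall>k. block_code f m x (k + r) = block_code f m x k"
proof -
  obtain r where r: "r > 0" "P' = (\<lambda>p. p - r) ` P" using constant_offset by blast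
  have "x' = (\<lambda>k. x (k + r))"
    using tiles_unique[OF tiles'] tiles_shift[OF tiles, of r] r by simp
  then have "block_code f m x (k + r) = block_code f m x' k" for k
    by (intro block_code_cong) (simp add: algebra_simps)
  then show ?thesis using r same by auto
qed

end

section \<open>Injectivity of aperiodic block codes\<close>

text \<open>Only finitely many \<open>d\<close> are involved, so the largest of their witnesses
  gives a common bound.\<close>

lemma uniform_nonperiod:
  fixes g :: "nat \<Rightarrow> nat"
  assumes "\<And>d. 1 \<le> d \<Longrightarrow> \<exists>i. g i \<noteq> g (i + d)"
  shows "\<exists>K. \<forall>d. 1 \<le> d \<and> d \<le> D \<longrightarrow> (\<exists>i. i + d + m \<le> K \<and> g i \<noteq> g (i + d))"
proof (induction D)
  case 0
  then show ?case by auto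
next
  case (Suc D)
  then obtain K where K: "\<And>d. 1 \<le> d \<Longrightarrow> d \<le> D \<Longrightarrow> \<exists>i. i + d + m \<le> K \<and> g i \<noteq> g (i + d)"
    by blast
  obtain i where i: "g i \<noteq> g (i + Suc D)" using assms[of "Suc D"] by auto
  have "\<exists>j. j + d + m \<le> max K (i + Suc D + m) \<and> g j \<noteq> g (j + d)"
    if d: "1 \<le> d" "d \<le> Suc D" for d
  proof (cases "d = Suc D")
    case True
    then show ?thesis using i by (intro exI[of _ i]) auto
  next
    case False
    then have "d \<le> D" using d by simp
    then show ?thesis using K[OF d(1)] by (meson max.coboundedI1)
  qed
  then show ?case by blast
qed

text \<open>Rank-one words enter only through their lengths \<open>len n\<close>: each is a prefix
  of \<open>V\<close>, ends every later one, and tiles both points.\<close>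

lemma aperiodic_block_code_inj:
  fixes V :: "nat \<Rightarrow> nat" and len :: "nat \<Rightarrow> nat" and x x' :: "int \<Rightarrow> nat"
  assumes V0: "V 0 = 0"
    and len: "\<And>n. n < len n" "\<And>n k. n \<le> k \<Longrightarrow> len n \<le> len k"
    and suffix: "\<And>n k i. n \<le> k \<Longrightarrow> i < len n \<Longrightarrow> V (len k - len n + i) = V i"
    and aper: "\<And>d. 1 \<le> d \<Longrightarrow> \<exists>i. block_code f m V i \<noteq> block_code f m V (i + d)"
    and tiled: "\<And>n. \<exists>P. tiles V (len n) P x" "\<And>n. \<exists>P. tiles V (len n) P x'"
    and same: "block_code f m x = block_code f m x'"
  shows "x = x'"
proof (rule ccontr)
  assume neq: "x \<noteq> x'"
  have "\<exists>K. \<forall>D d. 1 \<le> d \<and> d \<le> D \<longrightarrow>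
      (\<exists>i. i + d + m \<le> K D \<and> block_code f m V i \<noteq> block_code f m V (i + d))"
    using uniform_nonperiod[OF aper] by (intro choice) blast
  then obtain K where K: "\<And>D d. 1 \<le> d \<Longrightarrow> d \<le> D \<Longrightarrow>
      \<exists>i. i + d + m \<le> K D \<and> block_code f m V i \<noteq> block_code f m V (i + d)"
    by blast
  \<comment> \<open>\<open>K 1\<close> letters suffice to refute the period 1, that is, to see that
    the image is not constant; \<open>n < len n\<close> makes the word of level \<open>n0\<close>
    long enough.\<close>
  define n0 where "n0 = K 1"
  define l where "l = len n0"
  have l: "K 1 \<le> l" using len(1)[of n0] by (simp add: n0_def l_def)
  have level: "\<exists>L P P'. interleaved_collision V f m l L D x x' P P' \<and> P \<noteq> {}" if D: "l \<le> D" for D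
  proof -
    define n where "n = max n0 (K D)"
    define L where "L = len n"
    have L: "K D \<le> L" "l \<le> L"
      using len(1)[of n] len(2)[of n0 n] by (auto simp: n_def L_def l_def)
    obtain P P' where P: "tiles V L P x" "tiles V L P' x'" using tiled unfolding L_def by blast
    have coll: "tiled_collision V f m l L D x x' P P'"
    proof
      show "V (L - l + i) = V i" if "i < l" for i
        using suffix[of n0 n i] that by (simp add: n_def L_def l_def)
      show "\<exists>i. Suc i + m \<le> l \<and> block_code f m V i \<noteq> block_code f m V (Suc i)"
      proof -
        obtain i where "i + 1 + m \<le> K 1" "block_code f m V i \<noteq> block_code f m V (i + 1)"
          using K[of 1 1] by auto
        then show ?thesis using l by (intro exI[of _ i]) auto
      qed
      show "\<exists>i. i + d + m \<le> L \<and> block_code f m V i \<noteq> block_code f m V (i + d)"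
        if "1 \<le> d" "d \<le> D" for d
        using K[OF that] L by (meson order_trans)
    qed (use V0 D L P same in auto)
    have "P \<inter> P' = {}" using tiled_collision.aligned_imp_eq[OF coll] neq by blast
    then have inter: "interleaved_collision V f m l L D x x' P P'"
      using coll by (simp add: interleaved_collision_def interleaved_collision_axioms_def)
    \<comment> \<open>If one set of starts were empty, interleaving would empty the other, and both
      points would be constantly 1.\<close>
    have "P \<noteq> {}"
    proof
      assume "P = {}"
      then have "P' = {}"
        using interleaved_collision.previous[OF interleaved_collision.swap'[OF inter]] by blast
      then show False using tiles_unique P neq \<open>P = {}\<close> by blast
    qed
    then show ?thesis using inter by blast
  qed
  \<comment> \<open>First use, with \<open>D = l\<close>: only the resulting bound on runs of 1s is
    kept.\<close>
  obtain L P P' where 1: "interleaved_collision V f m l L l x x' P P'" "P \<noteq> {}"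
    using level[of l] by blast
  have "P' \<noteq> {}" using interleaved_collision.previous[OF 1(1)] 1(2) by blast
  define S where "S = 2 * L"
  have non_one: "\<exists>j. k \<le> j \<and> j < k + int S \<and> x j \<noteq> 1"
    "\<exists>j. k \<le> j \<and> j < k + int S \<and> x' j \<noteq> 1" for k
    using interleaved_collision.syndetic_non_one[OF 1]
      interleaved_collision.syndetic_non_one[OF interleaved_collision.swap'[OF 1(1)] \<open>P' \<noteq> {}\<close>]
    by (auto simp: S_def)
  \<comment> \<open>Second use, at a higher level: \<open>S\<close> is already fixed, so
    \<open>D\<close> may depend on it. The summand \<open>l\<close> serves \<open>level\<close>, the
    others serve \<open>D_large\<close>.\<close>
  obtain L' Q Q' where 2: "interleaved_collision V f m l L' (l + S + K S) x x' Q Q'" "Q \<noteq> {}"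
    using level[of "l + S + K S"] by auto
  have "rigid_collision V f m l L' (l + S + K S) x x' Q Q' S (K S)"
    using 2 non_one K by (simp add: rigid_collision_def rigid_collision_axioms_def)
  from rigid_collision.code_periodic[OF this]
  obtain r where r: "r > 0" "\<And>k. block_code f m x (k + r) = block_code f m x k" by blast
  \<comment> \<open>Since \<open>x\<close> is not constantly 1, it contains a copy of a prefix of
    \<open>V\<close> long enough to read off both values.\<close>
  have "block_code f m V i = block_code f m V (i + nat r)" for i
  proof -
    define n where "n = i + nat r + m"
    obtain P where P: "tiles V (len n) P x" using tiled by blast
    obtain j where "x j \<noteq> 1" using non_one by blast
    then obtain p where p: "p \<in> P" using tilesD(2)[OF P] by blast
    have "block_code f m V i = block_code f m x (p + int i)"
      using block_code_tile[OF P p, of i m f] len(1)[of n] by (simp add: n_def)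
    also have "\<dots> = block_code f m x (p + int i + r)" by (simp add: r)
    also have "p + int i + r = p + int (i + nat r)" using r by simp
    also have "block_code f m x \<dots> = block_code f m V (i + nat r)"
      using block_code_tile[OF P p, of "i + nat r" m f] len(1)[of n] by (simp add: n_def)
    finally show ?thesis .
  qed
  moreover have "1 \<le> nat r" using r(1) by linarith
  ultimately show False using aper by blast
qed

section \<open>Sliding block codes\<close>

lemma eventually_window_eq:
  fixes u :: "nat \<Rightarrow> int \<Rightarrow> nat"
  assumes "u \<longlonglongrightarrow> l" and "finite F"
  shows "eventually (\<lambda>k. \<forall>i\<in>F. u k i = l i) sequentially"
proof (rule eventually_ball_finite[OF assms(2)], rule)
  fix i
  have cont: "continuous_on UNIV (\<lambda>x :: int \<Rightarrow> nat. x i)" by simp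
  have "(\<lambda>k. u k i) \<longlonglongrightarrow> l i"
    using continuous_on_tendsto_compose[OF cont assms(1)] by simp
  then show "eventually (\<lambda>k. u k i = l i) sequentially" by (simp add: tendsto_discrete)
qed

lemma eventually_window_eq_imp_tendsto:
  fixes u :: "nat \<Rightarrow> int \<Rightarrow> nat"
  assumes "\<And>i. eventually (\<lambda>k. u k i = l i) sequentially"
  shows "u \<longlonglongrightarrow> l"
proof -
  have "limitin (product_topology (\<lambda>i. euclidean) UNIV) u l sequentially"
    unfolding limitin_componentwise using assms by (simp add: tendsto_discrete)
  then show ?thesis by (simp add: euclidean_product_topology)
qed

text \<open>The library has no metric or Hausdorff instance for \<open>int \<Rightarrow> nat\<close>, so such facts are imported
  from \<open>int \<Rightarrow> real\<close>.\<close>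

lemma continuous_on_real_seq: "continuous_on A (\<lambda>(x :: int \<Rightarrow> nat) k. real (x k))"
proof (rule continuous_on_coordinatewise_then_product)
  fix i
  have "continuous_on UNIV (\<lambda>x :: int \<Rightarrow> nat. x i)" by simp
  moreover have "continuous_on UNIV (real :: nat \<Rightarrow> real)" by simp
  ultimately have "continuous_on UNIV (\<lambda>x :: int \<Rightarrow> nat. real (x i))"
    using continuous_on_compose2[of UNIV real UNIV "\<lambda>x :: int \<Rightarrow> nat. x i"] by simp
  then show "continuous_on A (\<lambda>x :: int \<Rightarrow> nat. real (x i))"
    by (rule continuous_on_subset) simp
qed

lemma compact_pointwise_subsequence:
  fixes X :: "(int \<Rightarrow> nat) set" and u :: "nat \<Rightarrow> int \<Rightarrow> nat"
  assumes "compact X" and "\<And>k. u k \<in> X"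
  obtains l h where "l \<in> X" "strict_mono h" "(u \<circ> h) \<longlonglongrightarrow> l"
proof -
  define R where "R = (\<lambda>(x :: int \<Rightarrow> nat) k. real (x k))"
  have "compact (R ` X)"
    using compact_continuous_image[OF continuous_on_real_seq assms(1)] unfolding R_def .
  then have "seq_compact (R ` X)" by (rule compact_imp_seq_compact)
  moreover have "\<forall>k. R (u k) \<in> R ` X" using assms(2) by blast
  ultimately obtain z h where z: "z \<in> R ` X" "strict_mono h" "((\<lambda>k. R (u k)) \<circ> h) \<longlonglongrightarrow> z"
    by (rule seq_compactE[of "R ` X" "\<lambda>k. R (u k)"])
  then obtain l where l: "l \<in> X" "z = R l" by blast
  have "(u \<circ> h) \<longlonglongrightarrow> l"
  proof (rule eventually_window_eq_imp_tendsto)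
    fix i
    have cont: "continuous_on UNIV (\<lambda>x :: int \<Rightarrow> real. x i)" by simp
    have "(\<lambda>k. real (u (h k) i)) \<longlonglongrightarrow> real (l i)"
      using continuous_on_tendsto_compose[OF cont z(3)] by (simp add: R_def l(2))
    then have "eventually (\<lambda>k. dist (real (u (h k) i)) (real (l i)) < 1) sequentially"
      by (rule tendstoD) simp
    then show "eventually (\<lambda>k. (u \<circ> h) k i = l i) sequentially"
      by eventually_elim (simp add: dist_real_def)
  qed
  then show ?thesis using that l(1) z(2) by blast
qed

text \<open>With \<open>R\<close> the embedding into real sequences, \<open>R \<circ> \<phi>\<close>
  is a homeomorphism onto its image; composing its inverse with \<open>R\<close> inverts
  \<open>\<phi>\<close>.\<close>

lemma homeomorphism_compact_inj:
  fixes X Y :: "(int \<Rightarrow> nat) set"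
  assumes "compact X" and "continuous_on X \<phi>" and "\<phi> ` X = Y" and "inj_on \<phi> X"
  shows "\<exists>\<psi>. homeomorphism X Y \<phi> \<psi>"
proof -
  define R where "R = (\<lambda>(x :: int \<Rightarrow> nat) k. real (x k))"
  have cont: "continuous_on A R" for A unfolding R_def by (rule continuous_on_real_seq)
  have "inj R" by (auto simp: R_def inj_def fun_eq_iff)
  then have inj: "inj_on (R \<circ> \<phi>) X"
    using assms(4) by (intro comp_inj_on) (auto intro: inj_on_subset)
  have "continuous_on X (R \<circ> \<phi>)" using assms(2) cont by (intro continuous_on_compose)
  from homeomorphism_compact[OF assms(1) this refl inj]
  obtain g where g: "homeomorphism X ((R \<circ> \<phi>) ` X) (R \<circ> \<phi>) g" by blast
  have RY: "(R \<circ> \<phi>) ` X = R ` Y" using assms(3) by (metis image_comp)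
  have g1: "g (R (\<phi> x)) = x" if "x \<in> X" for x using g that by (simp add: homeomorphism_def)
  have "continuous_on (R ` Y) g" using g RY by (simp add: homeomorphism_def)
  then have "continuous_on Y (g \<circ> R)" using cont by (intro continuous_on_compose)
  then have "homeomorphism X Y \<phi> (g \<circ> R)"
    using assms(2,3) g1 unfolding homeomorphism_def by force
  then show ?thesis by blast
qed

lemma compact_full_shift: "compact (full_shift b)"
proof -
  have "compactin (product_topology (\<lambda>i::int. euclidean) UNIV) (PiE UNIV (\<lambda>_. {0..<b}))"
    by (simp add: compactin_PiE finite_imp_compact)
  moreover have "PiE UNIV (\<lambda>_::int. {0..<b}) = full_shift b"
    by (auto simp: full_shift_def PiE_iff)
  ultimately show ?thesis by (simp add: euclidean_product_topology)
qed

section \<open>Factor maps as block codes\<close>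

lemma translate_factor_map:
  assumes inv: "shift ` X = X" and eqv: "\<forall>x\<in>X. \<phi> (shift x) = shift (\<phi> x)" and "x \<in> X"
  shows "(\<lambda>k. x (k + r)) \<in> X \<and> \<phi> (\<lambda>k. x (k + r)) = (\<lambda>k. \<phi> x (k + r))"
proof (induction r rule: int_induct[where k = 0])
  case base
  then show ?case using assms(3) by simp
next
  case (step1 r)
  have eq: "(\<lambda>k. z (k + (r + 1))) = shift (\<lambda>k. z (k + r))" for z
    by (simp add: shift_def algebra_simps)
  have "shift (\<lambda>k. x (k + r)) \<in> X" using step1 inv by blast
  then show ?case using step1 eqv unfolding eq by simp
next
  case (step2 r)
  \<comment> \<open>Going backwards uses that the shift maps \<open>X\<close> onto itself.\<close>
  then obtain z where z: "z \<in> X" "(\<lambda>k. x (k + r)) = shift z" using inv by blast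
  have "z k = x (k + (r - 1))" for k using fun_cong[OF z(2), of "k - 1"] by (simp add: shift_def algebra_simps)
  then have zx: "z = (\<lambda>k. x (k + (r - 1)))" by blast
  have "\<phi> (shift z) = (\<lambda>k. \<phi> x (k + r))" using step2 z by simp
  then have "\<phi> x (k + r) = \<phi> z (k + 1)" for k using eqv z(1) by (metis shift_def)
  from this[of "_ - 1"] have "\<phi> z k = \<phi> x (k + (r - 1))" for k by (simp add: algebra_simps)
  then show ?case using z(1) unfolding zx by blast
qed

text \<open>This is the compactness step of the Curtis-Hedlund-Lyndon theorem: pairs that agree on
  growing windows but differ in image at 0 would converge, along a subsequence, to a common point,
  and continuity makes their images at 0 agree eventually.\<close>

lemma factor_map_local:
  fixes X :: "(int \<Rightarrow> nat) set"
  assumes "compact X" and "continuous_on X \<phi>"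
  shows "\<exists>N. \<forall>x\<in>X. \<forall>x'\<in>X. (\<forall>k. \<bar>k\<bar> \<le> int N \<longrightarrow> x k = x' k) \<longrightarrow> (\<phi> x :: int \<Rightarrow> nat) 0 = \<phi> x' 0"
proof (rule ccontr)
  assume neg: "\<not> ?thesis"
  define Q where "Q = (\<lambda>N x x'. x \<in> X \<and> x' \<in> X \<and> (\<forall>k. \<bar>k\<bar> \<le> int N \<longrightarrow> x k = x' k) \<and> \<phi> x 0 \<noteq> \<phi> x' 0)"
  have "\<forall>N. \<exists>x x'. Q N x x'" using neg unfolding Q_def by blast
  then obtain u u' where Q: "\<And>N. Q N (u N) (u' N)" by metis
  have u: "u N \<in> X" "u' N \<in> X" "\<bar>k\<bar> \<le> int N \<Longrightarrow> u N k = u' N k" "\<phi> (u N) 0 \<noteq> \<phi> (u' N) 0" for N k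
    using Q[of N] unfolding Q_def by blast+
  obtain x h where x: "x \<in> X" "strict_mono h" "(u \<circ> h) \<longlonglongrightarrow> x"
    by (rule compact_pointwise_subsequence[OF assms(1) u(1)])
  have "(u' \<circ> h) \<longlonglongrightarrow> x"
  proof (rule eventually_window_eq_imp_tendsto)
    fix i
    have "eventually (\<lambda>k. nat \<bar>i\<bar> \<le> k) sequentially" by (rule eventually_ge_at_top)
    then show "eventually (\<lambda>k. (u' \<circ> h) k i = x i) sequentially"
      using eventually_window_eq[OF x(3), of "{i}", simplified]
    proof eventually_elim
      case (elim k)
      then have "\<bar>i\<bar> \<le> int (h k)" using seq_suble[OF x(2), of k] by linarith
      then show ?case using u(3)[of i "h k"] elim by simp
    qed
  qed
  have conv: "(\<lambda>k. \<phi> (v k)) \<longlonglongrightarrow> \<phi> x" if "v \<longlonglongrightarrow> x" "\<And>k. v k \<in> X" for v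
    using continuous_on_tendsto_compose[OF assms(2) that(1) x(1)] that(2) by simp
  have "(\<lambda>k. \<phi> ((u \<circ> h) k)) \<longlonglongrightarrow> \<phi> x" "(\<lambda>k. \<phi> ((u' \<circ> h) k)) \<longlonglongrightarrow> \<phi> x"
    using conv[of "u \<circ> h"] conv[of "u' \<circ> h"] x \<open>(u' \<circ> h) \<longlonglongrightarrow> x\<close> u by simp_all
  from this[THEN eventually_window_eq, of "{0}", simplified]
  have "eventually (\<lambda>k. \<phi> (u (h k)) 0 = \<phi> (u' (h k)) 0) sequentially"
    by eventually_elim simp
  then show False using u(4) by simp
qed

text \<open>The displacement by \<open>N\<close> turns the centred window into one that only reaches
  to the right.\<close>

lemma factor_map_block_code:
  assumes "compact X" and inv: "shift ` X = X" and "is_factor_map X Y \<phi>"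
  shows "\<exists>f N. \<forall>x\<in>X. \<forall>k. \<phi> x (k + int N) = block_code f (2 * N + 1) x k"
proof -
  have cont: "continuous_on X \<phi>" and eqv: "\<forall>x\<in>X. \<phi> (shift x) = shift (\<phi> x)"
    using assms(3) by (simp_all add: is_factor_map_def)
  obtain N where N: "\<And>x x'. x \<in> X \<Longrightarrow> x' \<in> X \<Longrightarrow> (\<And>k. \<bar>k\<bar> \<le> int N \<Longrightarrow> x k = x' k) \<Longrightarrow> \<phi> x 0 = \<phi> x' 0"
    using factor_map_local[OF assms(1) cont] by blast
  define win where "win = (\<lambda>x :: int \<Rightarrow> nat. map (\<lambda>j. x (int j - int N)) [0..<2 * N + 1])"
  \<comment> \<open>Any point of \<open>X\<close> showing the window \<open>w\<close> gives the same
    value; on words that no point shows, the value is arbitrary.\<close>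
  define f where "f = (\<lambda>w. \<phi> (SOME x. x \<in> X \<and> win x = w) 0)"
  have win: "x k = x' k" if "win x = win x'" "\<bar>k\<bar> \<le> int N" for x x' k
  proof -
    have "nat (k + int N) < 2 * N + 1" using that(2) by linarith
    then have "win z ! nat (k + int N) = z (int (nat (k + int N)) - int N)" for z
      unfolding win_def by (subst nth_map_upt) auto
    moreover have "int (nat (k + int N)) - int N = k" using that(2) by linarith
    ultimately have "win z ! nat (k + int N) = z k" for z by simp
    then show ?thesis using that(1) by metis
  qed
  have f: "f (win x) = \<phi> x 0" if "x \<in> X" for x
  proof -
    have "(SOME z. z \<in> X \<and> win z = win x) \<in> X \<and> win (SOME z. z \<in> X \<and> win z = win x) = win x"
      using that by (intro someI[of "\<lambda>z. z \<in> X \<and> win z = win x"]) simp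
    then show ?thesis unfolding f_def using N win that by blast
  qed
  have "\<phi> x (k + int N) = block_code f (2 * N + 1) x k" if "x \<in> X" for x k
  proof -
    define z where "z = (\<lambda>j. x (j + (k + int N)))"
    have z: "z \<in> X" "\<phi> z = (\<lambda>j. \<phi> x (j + (k + int N)))"
      using translate_factor_map[OF inv eqv that, of "k + int N"] by (auto simp: z_def)
    have "win z = map (\<lambda>j. x (k + of_nat j)) [0..<2 * N + 1]"
      by (simp add: win_def z_def algebra_simps del: upt_Suc)
    then show ?thesis using f[OF z(1)] z(2) by (simp add: block_code_def del: upt_Suc)
  qed
  then show ?thesis by blast
qed

lemma finite_periodic:
  assumes "d > 0" and "\<And>y. y \<in> Y \<Longrightarrow> y \<in> full_shift b"
    and per: "\<And>y k. y \<in> Y \<Longrightarrow> y (k + int d) = y k"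
  shows "finite Y"
proof (rule finite_subset)
  have mult: "y (k + int d * j) = y k" if "y \<in> Y" for y k j
  proof (induction j rule: int_induct[where k = 0])
    case (step1 j)
    then show ?case using per[OF that, of "k + int d * j"] by (simp add: algebra_simps)
  next
    case (step2 j)
    then show ?case using per[OF that, of "k + int d * (j - 1)"] by (simp add: algebra_simps)
  qed simp
  show "Y \<subseteq> (\<lambda>w k. w ! nat (k mod int d)) ` {w. set w \<subseteq> {0..<b} \<and> length w = d}"
  proof
    fix y assume y: "y \<in> Y"
    have "y k = map (\<lambda>i. y (int i)) [0..<d] ! nat (k mod int d)" for k
      using mult[OF y, of "k mod int d" "k div int d"] assms(1) by (simp add: nat_less_iff)
    then have eq: "y = (\<lambda>k. map (\<lambda>i. y (int i)) [0..<d] ! nat (k mod int d))" by blast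
    have "map (\<lambda>i. y (int i)) [0..<d] \<in> {w. set w \<subseteq> {0..<b} \<and> length w = d}"
      using assms(2)[OF y] by (auto simp: full_shift_def)
    then show "y \<in> (\<lambda>w k. w ! nat (k mod int d)) ` {w. set w \<subseteq> {0..<b} \<and> length w = d}"
      by (rule rev_image_eqI) (rule eq)
  qed
  have "finite {w. set w \<subseteq> {0..<b} \<and> length w = d}"
    by (rule finite_lists_length_eq) simp
  then show "finite ((\<lambda>w (k::int). w ! nat (k mod int d)) ` {w. set w \<subseteq> {0..<b} \<and> length w = d})"
    by (rule finite_imageI)
qed

section \<open>Rank-one subshifts\<close>

lemma shift_space_window:
  assumes "x \<in> shift_space_of_word V"
  shows "\<exists>i. \<forall>j<m. x (k + int j) = V (i + j)"
proof -
  have "map (\<lambda>j. x (k + int j)) [0..<m] \<in> finite_subwords x"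
    unfolding finite_subwords_def by blast
  then have "map (\<lambda>j. x (k + int j)) [0..<m] \<in> finite_subwords_one_sided V"
    using assms by (auto simp: shift_space_of_word_def)
  then obtain i m' where eq: "map (\<lambda>j. x (k + int j)) [0..<m] = map (\<lambda>j. V (i + j)) [0..<m']"
    unfolding finite_subwords_one_sided_def by blast
  then have "m' = m" by (metis length_map length_upt diff_zero)
  with eq show ?thesis by (intro exI[of _ i]) simp
qed

lemma shift_shift_space: "shift ` shift_space_of_word V = shift_space_of_word V"
proof -
  have sub: "(\<lambda>k. x (k + r)) \<in> shift_space_of_word V" if "x \<in> shift_space_of_word V" for x r
  proof -
    have "finite_subwords (\<lambda>k. x (k + r)) \<subseteq> finite_subwords x"
    proof
      fix w assume "w \<in> finite_subwords (\<lambda>k. x (k + r))"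
      then obtain i m where "w = map (\<lambda>j. x (i + int j + r)) [0..<m]"
        unfolding finite_subwords_def by blast
      then have "w = map (\<lambda>j. x ((i + r) + int j)) [0..<m]" by (simp add: algebra_simps)
      then show "w \<in> finite_subwords x" unfolding finite_subwords_def by blast
    qed
    then show ?thesis using that by (auto simp: shift_space_of_word_def full_shift_def)
  qed
  have "x = shift (\<lambda>k. x (k + - 1))" for x by (simp add: shift_def)
  then have "shift_space_of_word V \<subseteq> shift ` shift_space_of_word V"
    using sub[of _ "- 1"] by (intro subsetI) (rule image_eqI)
  moreover have "shift ` shift_space_of_word V \<subseteq> shift_space_of_word V"
    using sub[of _ 1] by (auto simp: shift_def)
  ultimately show ?thesis by (rule subset_antisym[rotated])
qed

text \<open>A bad word in \<open>y\<close> rules out the whole cylinder of points agreeing with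
  \<open>y\<close> there, so the complement of the subword condition is open.\<close>

lemma compact_shift_space: "compact (shift_space_of_word V)"
proof -
  have cylinder: "open {z. \<forall>i\<in>F. z i = y i}" if "finite F" for F and y :: "int \<Rightarrow> nat"
    using product_topology_basis'[OF that, of "\<lambda>i. {y i}" "\<lambda>i. i"] by (simp add: open_discrete)
  have "open (- {x. finite_subwords x \<subseteq> finite_subwords_one_sided V})"
    unfolding open_subopen[of "- _"]
  proof
    fix y assume "y \<in> - {x. finite_subwords x \<subseteq> finite_subwords_one_sided V}"
    then obtain i m where w: "map (\<lambda>j. y (i + int j)) [0..<m] \<notin> finite_subwords_one_sided V"
      unfolding finite_subwords_def by blast
    let ?C = "{z. \<forall>k\<in>{i..<i + int m}. z k = y k}"
    have "\<not> finite_subwords z \<subseteq> finite_subwords_one_sided V" if "z \<in> ?C" for z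
    proof -
      have "map (\<lambda>j. y (i + int j)) [0..<m] = map (\<lambda>j. z (i + int j)) [0..<m]"
        using that by simp
      then have "map (\<lambda>j. y (i + int j)) [0..<m] \<in> finite_subwords z"
        unfolding finite_subwords_def by blast
      then show ?thesis using w by blast
    qed
    then show "\<exists>T. open T \<and> y \<in> T \<and> T \<subseteq> - {x. finite_subwords x \<subseteq> finite_subwords_one_sided V}"
      using cylinder[of "{i..<i + int m}" y] by (intro exI[of _ ?C]) auto
  qed
  then have "compact (full_shift 2 \<inter> {x. finite_subwords x \<subseteq> finite_subwords_one_sided V})"
    by (intro compact_Int_closed compact_full_shift) (simp add: closed_def)
  moreover have "shift_space_of_word V =
      full_shift 2 \<inter> {x. finite_subwords x \<subseteq> finite_subwords_one_sided V}"
    by (auto simp: shift_space_of_word_def)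
  ultimately show ?thesis by simp
qed

text \<open>The finite counterpart of \<open>tiles\<close>; all copies lie inside \<open>w\<close>,
  so that tilings can be concatenated.\<close>

definition word_tiles :: "nat list \<Rightarrow> nat set \<Rightarrow> nat list \<Rightarrow> bool" where
  "word_tiles v D w \<longleftrightarrow>
     (\<forall>d\<in>D. d + length v \<le> length w \<and> (\<forall>i<length v. w ! (d + i) = v ! i)) \<and>
     (\<forall>k<length w. w ! k \<noteq> 1 \<longrightarrow> (\<exists>d\<in>D. d \<le> k \<and> k < d + length v)) \<and>
     (\<forall>d\<in>D. \<forall>d'\<in>D. d < d' \<longrightarrow> d + length v \<le> d')"

lemma word_tiles_append:
  assumes "word_tiles v D w" and "word_tiles v D' w'"
  shows "word_tiles v (D \<union> (+) (length w) ` D') (w @ w')"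
  unfolding word_tiles_def
proof (intro conjI ballI allI impI)
  fix d assume "d \<in> D \<union> (+) (length w) ` D'"
  then consider "d \<in> D" | e where "e \<in> D'" "d = length w + e" by blast
  then show "d + length v \<le> length (w @ w')"
  proof cases
    case 1
    then have "d + length v \<le> length w" using assms(1) unfolding word_tiles_def by blast
    then show ?thesis by simp
  next
    case 2
    then have "e + length v \<le> length w'" using assms(2) unfolding word_tiles_def by blast
    then show ?thesis using 2 by simp
  qed
next
  fix d i assume "d \<in> D \<union> (+) (length w) ` D'" and i: "i < length v"
  then consider "d \<in> D" | e where "e \<in> D'" "d = length w + e" by blast
  then show "(w @ w') ! (d + i) = v ! i"
  proof cases
    case 1
    then have "d + length v \<le> length w" "w ! (d + i) = v ! i"
      using assms(1) i unfolding word_tiles_def by blast+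
    then show ?thesis using i by (simp add: nth_append)
  next
    case 2
    then have "w' ! (e + i) = v ! i" using assms(2) i unfolding word_tiles_def by blast
    then show ?thesis using 2 by (simp add: nth_append)
  qed
next
  fix k assume k: "k < length (w @ w')" "(w @ w') ! k \<noteq> 1"
  show "\<exists>d\<in>D \<union> (+) (length w) ` D'. d \<le> k \<and> k < d + length v"
  proof (cases "k < length w")
    case True
    then show ?thesis using k assms(1) unfolding word_tiles_def by (auto simp: nth_append)
  next
    case False
    then have "k - length w < length w'" "w' ! (k - length w) \<noteq> 1"
      using k by (auto simp: nth_append)
    then obtain d where "d \<in> D'" "d \<le> k - length w" "k - length w < d + length v"
      using assms(2) unfolding word_tiles_def by blast
    then show ?thesis using False by (intro bexI[of _ "length w + d"]) auto
  qed
next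
  have D: "d + length v \<le> length w" "d' \<in> D \<Longrightarrow> d < d' \<Longrightarrow> d + length v \<le> d'" if "d \<in> D" for d d'
    using assms(1) that unfolding word_tiles_def by blast+
  have D': "d + length v \<le> d'" if "d \<in> D'" "d' \<in> D'" "d < d'" for d d'
    using assms(2) that unfolding word_tiles_def by blast
  fix d d' assume "d \<in> D \<union> (+) (length w) ` D'" "d' \<in> D \<union> (+) (length w) ` D'" "d < d'"
  then consider "d \<in> D" "d' \<in> D" | e' where "d \<in> D" "d' = length w + e'"
    | e where "d = length w + e" "d' \<in> D"
    | e e' where "e \<in> D'" "e' \<in> D'" "d = length w + e" "d' = length w + e'"
    by blast
  then show "d + length v \<le> d'"
  proof cases
    case 1
    then show ?thesis using D(2) \<open>d < d'\<close> by blast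
  next
    case 2
    then show ?thesis using D(1)[of d] by simp
  next
    case 3
    then show ?thesis using D(1)[of d'] \<open>d < d'\<close> by simp
  next
    case 4
    then show ?thesis using D'[of e e'] \<open>d < d'\<close> by simp
  qed
qed

lemma word_tiles_concat:
  assumes "\<And>w. w \<in> set ws \<Longrightarrow> \<exists>D. word_tiles v D w"
  shows "\<exists>D. word_tiles v D (concat ws)"
  using assms
proof (induction ws)
  case Nil
  then show ?case by (intro exI[of _ "{}"]) (simp add: word_tiles_def)
next
  case (Cons w ws)
  obtain D where "word_tiles v D w" using Cons.prems by auto
  moreover obtain D' where "word_tiles v D' (concat ws)" using Cons by auto
  ultimately show ?case using word_tiles_append by fastforce
qed

lemma word_tiles_rank_one_word:
  assumes "n \<le> k"
  shows "\<exists>D. word_tiles (rank_one_word q a n) D (rank_one_word q a k)"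
  using assms
proof (induction k rule: dec_induct)
  case base
  show ?case by (intro exI[of _ "{0}"]) (auto simp: word_tiles_def)
next
  case (step k)
  then obtain D where D: "word_tiles (rank_one_word q a n) D (rank_one_word q a k)" by blast
  have ones: "word_tiles (rank_one_word q a n) {} (replicate s 1)" for s
    by (simp add: word_tiles_def)
  have "\<exists>D. word_tiles (rank_one_word q a n) D (rank_one_word q a k @ replicate s 1)" for s
    using word_tiles_append[OF D ones] by blast
  then have "\<exists>D. word_tiles (rank_one_word q a n) D
      (concat (map (\<lambda>i. rank_one_word q a k @ replicate (a k i) 1) [1..<q k]))"
    by (intro word_tiles_concat) auto
  then show ?case using word_tiles_append[OF _ D] by auto
qed

lemma rank_one_limit_nth:
  assumes "\<And>n. q n > 1" and "k < length (rank_one_word q a n)"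
  shows "rank_one_limit q a k = rank_one_word q a n ! k"
proof -
  have "map (rank_one_limit q a) [0..<length (rank_one_word q a n)] ! k = rank_one_word q a n ! k"
    by (simp only: prefix_rank_one_limit[OF assms(1)])
  then show ?thesis using assms(2) by simp
qed

lemma suffix_rank_one_word:
  assumes "n \<le> k"
  shows "suffix (rank_one_word q a n) (rank_one_word q a k)"
  using assms
proof (induction k rule: dec_induct)
  case (step k)
  have "suffix (rank_one_word q a k) (rank_one_word q a (Suc k))" by (simp add: suffix_def)
  then show ?case using step.IH suffix_order.trans by blast
qed simp

text \<open>Every window of \<open>x\<close> occurs in some long rank-one word and inherits its
  tiling. Compactness, applied to the sets of starts, yields a tiling of all of
  \<open>x\<close>.\<close>

lemma tiles_shift_space:
  assumes q: "\<And>n. q n > 1" and x: "x \<in> shift_space_of_word (rank_one_limit q a)"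
  shows "\<exists>P. tiles (rank_one_limit q a) (length (rank_one_word q a n)) P x"
proof -
  define V where "V = rank_one_limit q a"
  define L where "L = length (rank_one_word q a n)"
  \<comment> \<open>Tiles that stick out of the window from \<open>- k\<close> to \<open>k\<close>
    need to match only inside it.\<close>
  define loc where "loc = (\<lambda>k P.
      (\<forall>p\<in>P. \<forall>i<L. \<bar>p + int i\<bar> \<le> int k \<longrightarrow> x (p + int i) = V i) \<and>
      (\<forall>j. \<bar>j\<bar> \<le> int k \<longrightarrow> x j \<noteq> 1 \<longrightarrow> (\<exists>p\<in>P. p \<le> j \<and> j < p + int L)) \<and>
      (\<forall>p\<in>P. \<forall>p'\<in>P. p < p' \<longrightarrow> p + int L \<le> p'))"
  have "\<exists>P. loc k P" for k
  proof -
    obtain i where i: "\<forall>j<2 * k + 1. x (- int k + int j) = V (i + j)"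
      using shift_space_window[OF x] unfolding V_def by blast
    \<comment> \<open>The summand \<open>n\<close> makes level \<open>n\<close> words tile
      \<open>w\<close>; the rest makes \<open>w\<close> long enough to contain the window found at
      \<open>i\<close>.\<close>
    define M where "M = n + (i + (2 * k + 1))"
    define w where "w = rank_one_word q a M"
    have lw: "i + (2 * k + 1) < length w"
      using length_rank_one_word[of q M a] q by (simp add: w_def M_def)
    have Vw: "V j = w ! j" if "j < length w" for j
      using rank_one_limit_nth[of q] q that by (simp add: V_def w_def)
    obtain D where D: "word_tiles (rank_one_word q a n) D w"
      using word_tiles_rank_one_word[of n M] by (auto simp: w_def M_def)
    define P where "P = (\<lambda>d. int d - int i - int k) ` D"
    have xw: "x j = w ! nat (j + int k + int i)" if "\<bar>j\<bar> \<le> int k" for j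
    proof -
      have "nat (j + int k) < 2 * k + 1" using that by linarith
      then have "x (- int k + int (nat (j + int k))) = V (i + nat (j + int k))" using i by blast
      moreover have "i + nat (j + int k) = nat (j + int k + int i)" using that by linarith
      moreover have "nat (j + int k + int i) < length w" using lw that by linarith
      moreover have "- int k + int (nat (j + int k)) = j" using that by linarith
      ultimately show ?thesis using Vw by metis
    qed
    have "loc k P"
      unfolding loc_def
    proof (intro conjI ballI allI impI)
      fix p t assume "p \<in> P" and t: "t < L" "\<bar>p + int t\<bar> \<le> int k"
      then obtain d where d: "d \<in> D" "p = int d - int i - int k" by (auto simp: P_def)
      have "x (p + int t) = w ! (d + t)"
        using xw[OF t(2)] d(2) by (simp add: nat_int_add flip: of_nat_add)
      also have "\<dots> = rank_one_word q a n ! t" using D d(1) t(1) unfolding word_tiles_def L_def by blast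
      also have "\<dots> = V t" using rank_one_limit_nth[of q] q t(1) by (simp add: V_def L_def)
      finally show "x (p + int t) = V t" .
    next
      fix j assume j: "\<bar>j\<bar> \<le> int k" "x j \<noteq> 1"
      have "nat (j + int k + int i) < length w" using lw j by linarith
      moreover have "w ! nat (j + int k + int i) \<noteq> 1" using xw j by simp
      ultimately obtain d where "d \<in> D" "d \<le> nat (j + int k + int i)" "nat (j + int k + int i) < d + L"
        using D unfolding word_tiles_def L_def by blast
      then show "\<exists>p\<in>P. p \<le> j \<and> j < p + int L"
        using j by (intro bexI[of _ "int d - int i - int k"]) (auto simp: P_def)
    next
      fix p p' assume "p \<in> P" "p' \<in> P" "p < p'"
      then obtain d d' where "d \<in> D" "d' \<in> D" "d < d'" "p = int d - int i - int k"
        "p' = int d' - int i - int k" by (auto simp: P_def)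
      moreover from this have "d + L \<le> d'" using D unfolding word_tiles_def L_def by blast
      ultimately show "p + int L \<le> p'" by simp
    qed
    then show ?thesis by blast
  qed
  then obtain P where P: "\<And>k. loc k (P k)" by metis
  \<comment> \<open>Indicator sequences turn the sets of starts into points of the compact space
    \<open>full_shift 2\<close>.\<close>
  define u where "u = (\<lambda>k j. if j \<in> P k then 1 else 0 :: nat)"
  have "u k \<in> full_shift 2" for k by (simp add: u_def full_shift_def)
  from compact_pointwise_subsequence[OF compact_full_shift this]
  obtain I h where I: "strict_mono h" "(u \<circ> h) \<longlonglongrightarrow> I" .
  define R where "R = {j. I j = 1}"
  have agree: "\<exists>k. B \<le> k \<and> (\<forall>j\<in>F. j \<in> R \<longleftrightarrow> j \<in> P k)" if "finite F" for F B
  proof -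
    have "eventually (\<lambda>k. B \<le> k \<and> (\<forall>j\<in>F. (u \<circ> h) k j = I j)) sequentially"
      using eventually_ge_at_top eventually_window_eq[OF I(2) that] by (rule eventually_conj)
    then obtain k where k: "B \<le> k" "\<forall>j\<in>F. u (h k) j = I j"
      by (auto simp: eventually_sequentially)
    then have "B \<le> h k" using seq_suble[OF I(1), of k] by linarith
    moreover have "\<forall>j\<in>F. j \<in> R \<longleftrightarrow> j \<in> P (h k)" using k(2) by (auto simp: R_def u_def split: if_splits)
    ultimately show ?thesis by blast
  qed
  have "tiles V L R x"
    unfolding tiles_def
  proof (intro conjI ballI allI impI)
    fix p i assume p: "p \<in> R" and i: "i < L"
    obtain k where k: "nat \<bar>p + int i\<bar> \<le> k" "p \<in> P k" using agree[of "{p}"] p by blast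
    then show "x (p + int i) = V i" using P[of k] i unfolding loc_def by simp
  next
    fix j assume j: "x j \<noteq> 1"
    \<comment> \<open>A tile covering \<open>j\<close> starts in this finite interval, so agreement
      of \<open>R\<close> and \<open>P k\<close> there suffices.\<close>
    obtain k where k: "nat \<bar>j\<bar> \<le> k" "\<forall>s\<in>{j - int L..j}. s \<in> R \<longleftrightarrow> s \<in> P k"
      using agree[of "{j - int L..j}"] by blast
    have "\<bar>j\<bar> \<le> int k" using k(1) by linarith
    then obtain p where p: "p \<in> P k" "p \<le> j" "j < p + int L"
      using P[of k] j unfolding loc_def by blast
    then have "p \<in> {j - int L..j}" by simp
    then show "\<exists>p\<in>R. p \<le> j \<and> j < p + int L" using k(2) p by blast
  next
    fix p p' assume p: "p \<in> R" "p' \<in> R" "p < p'"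
    obtain k where "p \<in> P k" "p' \<in> P k" using agree[of "{p, p'}" 0] p by blast
    then show "p + int L \<le> p'" using P[of k] p(3) unfolding loc_def by blast
  qed
  then show ?thesis unfolding V_def L_def by blast
qed

lemma shift_space_code_periodic:
  assumes "x \<in> shift_space_of_word V"
    and "\<And>i. block_code f m V i = block_code f m V (i + d)"
  shows "block_code f m x (k + int d) = block_code f m x k"
proof -
  obtain i where i: "\<forall>j<d + m. x (k + int j) = V (i + j)"
    using shift_space_window[OF assms(1)] by blast
  have "block_code f m x (k + int d) = block_code f m V (i + d)"
  proof (rule block_code_cong)
    fix j assume "j < m"
    then have "x (k + int (d + j)) = V (i + (d + j))" using i[rule_format, of "d + j"] by simp
    then show "x (k + int d + of_nat j) = V (i + d + of_nat j)" by (simp add: add.assoc)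
  qed
  also have "\<dots> = block_code f m V i" using assms(2) by simp
  also have "\<dots> = block_code f m x k"
    by (rule block_code_cong) (use i in simp)
  finally show ?thesis .
qed

theorem mainTheorem1:
  fixes X Y :: "(int \<Rightarrow> nat) set"
  assumes "rank_one_subshift X"
    and "subshift Y"
    and "topological_factor Y X"
  shows "finite Y \<or> topologically_isomorphic X Y"
proof -
  obtain q a where q: "\<And>n. q n > 1" and X: "X = shift_space_of_word (rank_one_limit q a)"
    using assms(1) by (auto simp: rank_one_subshift_def)
  define V where "V = rank_one_limit q a"
  define len where "len = (\<lambda>n. length (rank_one_word q a n))"
  obtain \<phi> where \<phi>: "is_factor_map X Y \<phi>" using assms(3) by (auto simp: topological_factor_def)
  then have surj: "\<phi> ` X = Y" and cont: "continuous_on X \<phi>" by (simp_all add: is_factor_map_def)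
  obtain b where b: "Y \<subseteq> full_shift b" using assms(2) by (auto simp: subshift_def)
  have comp: "compact X" unfolding X by (rule compact_shift_space)
  obtain f N where f: "\<And>x k. x \<in> X \<Longrightarrow> \<phi> x (k + int N) = block_code f (2 * N + 1) x k"
    using factor_map_block_code[OF comp _ \<phi>] shift_shift_space X by blast
  define m where "m = 2 * N + 1"
  show ?thesis
  \<comment> \<open>A period of the coded \<open>V\<close> passes to every point of
    \<open>Y\<close>, as each window of \<open>x\<close> occurs in \<open>V\<close>; without one,
    the code is injective on \<open>X\<close>.\<close>
  proof (cases "\<exists>d\<ge>1. \<forall>i. block_code f m V i = block_code f m V (i + d)")
    case True
    then obtain d where d: "d \<ge> 1" "\<And>i. block_code f m V i = block_code f m V (i + d)" by blast
    have "y (k + int d) = y k" if y: "y \<in> Y" for y k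
    proof -
      obtain x where x: "x \<in> X" "y = \<phi> x" using y surj by blast
      have "block_code f m x (k - int N + int d) = block_code f m x (k - int N)"
        using shift_space_code_periodic d x(1) unfolding X V_def by blast
      then show ?thesis
        using f[OF x(1), of "k - int N"] f[OF x(1), of "k - int N + int d"]
        by (simp add: x(2) m_def algebra_simps)
    qed
    then have "finite Y" using finite_periodic[of d Y b] d(1) b by auto
    then show ?thesis by blast
  next
    case False
    have V_nth: "V i = rank_one_word q a n ! i" if "i < len n" for n i
      using rank_one_limit_nth[of q] q that by (simp add: V_def len_def)
    have len: "n < len n" for n using length_rank_one_word[of q] q by (simp add: len_def)
    have mono: "len n \<le> len k" if "n \<le> k" for n k
      using suffix_length_le[OF suffix_rank_one_word[OF that]] by (simp add: len_def)
    have suffix: "V (len k - len n + i) = V i" if "n \<le> k" "i < len n" for n k i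
    proof -
      have "Sublist.suffix (rank_one_word q a n) (rank_one_word q a k)"
        using that(1) by (rule suffix_rank_one_word)
      then obtain w where w: "rank_one_word q a k = w @ rank_one_word q a n"
        by (auto simp: suffix_def)
      then have "len k = length w + len n" by (simp add: len_def)
      then have "V (len k - len n + i) = rank_one_word q a k ! (length w + i)"
        using V_nth[of "length w + i" k] that(2) by simp
      also have "\<dots> = rank_one_word q a n ! i" by (simp add: w)
      finally show ?thesis using V_nth that(2) by simp
    qed
    have "inj_on \<phi> X"
    proof (rule inj_onI)
      fix x x' assume x: "x \<in> X" "x' \<in> X" "\<phi> x = \<phi> x'"
      show "x = x'"
      proof (rule aperiodic_block_code_inj[where V = V and len = len and f = f and m = m])
        show "V 0 = 0" using V_nth[of 0 0] len[of 0] by simp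
        show "\<exists>P. tiles V (len n) P x" "\<exists>P. tiles V (len n) P x'" for n
          using tiles_shift_space[of q] q x unfolding V_def len_def X by blast+
        show "block_code f m x = block_code f m x'"
          using f[OF x(1)] f[OF x(2)] x(3) by (simp add: fun_eq_iff m_def)
      qed (use len mono suffix False in auto)
    qed
    then have "\<exists>\<psi>. homeomorphism X Y \<phi> \<psi>"
      using homeomorphism_compact_inj[OF comp cont surj] by blast
    then show ?thesis using \<phi> by (auto simp: topologically_isomorphic_def)
  qed
qed

end
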